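(* Let ${\rm K}_{n,\infty}$ be the sharp (smallest possible) constant in the inequality $|f^{(n)}(z)|\le \frac{{\rm K}_{n,\infty}}{(\Im z)^{n}}\|\Re f\|_\infty$, valid for all analytic functions $f$ in $\mathbb{C}_+$ with $\Re f\in h^\infty(\mathbb{R}^2_+)$ and all points $z\in\mathbb{C}_+$. Then for every integer $m\ge 1$, $$\frac{2}{\pi}\big((2m-1)!!\big)^2<{\rm K}_{2m,\infty}<\frac{2m}{2m-1}\,\frac{2}{\pi}\big((2m-1)!!\big)^2 .$$
   Context: $\mathbb{C}_+=\{z\in\mathbb{C}:\Im z>0\}$, identified with $\mathbb{R}^2_+$. $h^\infty(\mathbb{R}^2_+)$ is the space of harmonic functions in the upper half-plane of the form $u(x+iy)=\frac{1}{\pi}\int_{-\infty}^{\infty}\frac{y\,g(t)}{(x-t)^2+y^2}\,dt$ with real $g\in L^\infty(-\infty,\infty)$; $\|\Re f\|_\infty$ denotes the $L^\infty(-\infty,\infty)$ norm of the boundary values $g$ of $\Re f$ on $\mathbb{R}$. A previously known representation (Kresin and Maz'ya) is $${\rm K}_{2m,\infty}=\frac{(2m)!}{\pi}\max_{\alpha\in\mathbb{R}}\int_{-\pi/2}^{\pi/2}\big|\cos(\alpha-(2m+1)\varphi)\big|\cos^{2m-1}\varphi\,d\varphi .$$ $k!!$ denotes the double factorial. *)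

theory Defs
  imports
    "HOL-Complex_Analysis.Complex_Analysis"
    "HOL-Probability.Essential_Supremum"
begin

definition upper_half_plane :: "complex set" where
  "upper_half_plane = {z. Im z > 0}"

definition Linfty :: "(real \<Rightarrow> real) set" where
  "Linfty = {g. g \<in> borel_measurable lebesgue \<and> esssup lebesgue (\<lambda>t. ereal \<bar>g t\<bar>) < \<infinity>}"

text \<open>The conversion from \<^typ>\<open>ereal\<close> is lossless on \<open>Linfty\<close>.\<close>

definition Linfty_norm :: "(real \<Rightarrow> real) \<Rightarrow> real" where
  "Linfty_norm g = real_of_ereal (esssup lebesgue (\<lambda>t. ereal \<bar>g t\<bar>))"

definition poisson_integral :: "(real \<Rightarrow> real) \<Rightarrow> complex \<Rightarrow> real" where
  "poisson_integral g z =
     1 / pi * (LINT t|lebesgue. Im z * g t / ((Re z - t)\<^sup>2 + (Im z)\<^sup>2))"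

text \<open>
  \<open>has_boundary_values u g\<close> says that \<open>u\<close>, restricted to the upper half-plane, belongs to
  \<open>h\<^sup>\<infinity>\<close> and is represented by \<open>g\<close>. By Fatou's theorem \<open>g\<close> is then determined by \<open>u\<close>
  almost everywhere, so that \<open>Linfty_norm g\<close> depends only on \<open>u\<close>.
\<close>

definition has_boundary_values :: "(complex \<Rightarrow> real) \<Rightarrow> (real \<Rightarrow> real) \<Rightarrow> bool" where
  "has_boundary_values u g \<longleftrightarrow>
     g \<in> Linfty \<and> (\<forall>z\<in>upper_half_plane. u z = poisson_integral g z)"

definition derivative_estimate :: "nat \<Rightarrow> real \<Rightarrow> bool" where
  "derivative_estimate n C \<longleftrightarrow>
     (\<forall>f g. f analytic_on upper_half_plane \<longrightarrow> has_boundary_values (\<lambda>z. Re (f z)) g \<longrightarrow>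
        (\<forall>z\<in>upper_half_plane. norm ((deriv ^^ n) f z) \<le> C / Im z ^ n * Linfty_norm g))"

definition is_sharp_constant :: "nat \<Rightarrow> real \<Rightarrow> bool" where
  "is_sharp_constant n K \<longleftrightarrow>
     derivative_estimate n K \<and> (\<forall>C. derivative_estimate n C \<longrightarrow> K \<le> C)"

lemma is_sharp_constant_unique:
  "is_sharp_constant n K \<Longrightarrow> is_sharp_constant n K' \<Longrightarrow> K = K'"
  unfolding is_sharp_constant_def by (meson order_antisym)

fun double_fact :: "nat \<Rightarrow> nat" where
  "double_fact 0 = 1"
| "double_fact (Suc 0) = 1"
| "double_fact (Suc (Suc n)) = Suc (Suc n) * double_fact n"

end

theory Submission
  imports Defs "HOL-Probability.Sinc_Integral"
begin

text \<open>
  Differentiating the Herglotz representation of \<open>f\<close> gives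
  \<open>f\<^sup>(\<^sup>n\<^sup>)(z) = n! / (\<pi> \<i>) \<integral> g(t) / (t - z)\<^sup>n\<^sup>+\<^sup>1 dt\<close>. Rotating the phase of this integral, duality
  between \<open>L\<^sup>1\<close> and \<open>L\<^sup>\<infinity>\<close> (with \<open>g\<close> the sign of the real part of the rotated kernel as extremal
  function) and the substitution \<open>t = Re z + Im z tan x\<close> show that the sharp constant is
  \<open>n! / \<pi>\<close> times the supremum over \<open>\<alpha>\<close> of \<open>\<integral> \<bar>cos (\<alpha> - (n + 1) x)\<bar> cos\<^sup>n\<^sup>-\<^sup>1 x dx\<close> over \<open>[-\<pi>/2, \<pi>/2]\<close>.

  For \<open>n = 2m\<close> the odd power \<open>cos\<^sup>2\<^sup>m\<^sup>-\<^sup>1\<close> is squeezed between combinations of neighbouring even powers.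
  An even power \<open>cos\<^sup>2\<^sup>p\<close> is a trigonometric polynomial in \<open>2x\<close> of degree \<open>p\<close>, so for
  \<open>p < b = 2m + 1\<close> all its nonconstant modes are orthogonal to the \<open>\<pi>/b\<close>-periodic weight
  \<open>\<bar>cos (\<alpha> - b x)\<bar>\<close>: the weight may be replaced by its mean \<open>2/\<pi>\<close>, and only Wallis integrals remain.
\<close>

subsection \<open>The mean of \<open>\<bar>cos\<bar>\<close> against even powers of the cosine\<close>

text \<open>For a \<le> b the integral over [a, b+T] splits both at a+T and at b; the outer pieces
  [a, b] and [a+T, b+T] agree by periodicity and cancel.\<close>

lemma integral_periodic_interval:
  fixes f :: "real \<Rightarrow> 'a::euclidean_space"
  assumes "continuous_on UNIV f" "\<And>x. f (x + T) = f x" "T \<ge> 0"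
  shows "integral {a..a+T} f = integral {b..b+T} f"
proof -
  have *: "integral {a..a+T} f = integral {b..b+T} f" if "a \<le> b" for a b
  proof -
    have int: "f integrable_on {c..d}" for c d
      using assms(1) continuous_on_subset integrable_continuous_interval by blast
    have "integral {a..a+T} f + integral {a+T..b+T} f = integral {a..b} f + integral {b..b+T} f"
      using that assms(3) int by (simp add: Henstock_Kurzweil_Integration.integral_combine)
    moreover have "integral {a+T..b+T} f = integral {a..b} f"
      using integral_shift_Icc_real[of a b f T] assms(2) by (simp add: o_def add.commute)
    ultimately show ?thesis by simp
  qed
  show ?thesis
  proof (cases "a \<le> b")
    case True
    then show ?thesis by (rule *)
  next
    case False
    then show ?thesis by (intro *[symmetric]) simp
  qed
qed

lemma integral_periodic_multiple:
  fixes f :: "real \<Rightarrow> 'a::euclidean_space"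
  assumes "continuous_on UNIV f" "\<And>x. f (x + T) = f x" "T \<ge> 0"
  shows "integral {a..a + real n * T} f = real n *\<^sub>R integral {b..b+T} f"
proof (induction n)
  case (Suc n)
  have "f integrable_on {c..d}" for c d
    using assms(1) continuous_on_subset integrable_continuous_interval by blast
  then have "integral {a..a + real (Suc n) * T} f
      = integral {a..a + real n * T} f + integral {a + real n * T..(a + real n * T) + T} f"
    using assms(3) by (subst Henstock_Kurzweil_Integration.integral_combine) (auto simp: algebra_simps)
  also have "integral {a + real n * T..(a + real n * T) + T} f = integral {b..b+T} f"
    by (rule integral_periodic_interval) (use assms in auto)
  finally show ?case using Suc.IH by (simp add: algebra_simps)
qed auto

lemma integral_abs_cos_half_period: "integral {- (pi/2)..pi/2} (\<lambda>x. \<bar>cos x\<bar>) = 2"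
proof -
  have "(cos has_integral sin (pi/2) - sin (- (pi/2))) {- (pi/2)..pi/2}"
    by (intro fundamental_theorem_of_calculus)
       (auto simp flip: has_real_derivative_iff_has_vector_derivative intro!: derivative_eq_intros)
  then have "((\<lambda>x. \<bar>cos x\<bar>) has_integral 2) {- (pi/2)..pi/2}"
    by (rule has_integral_eq_rhs[OF has_integral_eq, rotated]) (auto simp: cos_ge_zero)
  then show ?thesis by (rule integral_unique)
qed

text \<open>The substitution u = b x - \<alpha> maps the interval onto b full periods of |cos|, each
  contributing 2, and the Jacobian 1/b cancels their number.\<close>

lemma integral_abs_cos_scaled:
  assumes "b > 0"
  shows "integral {- (pi/2)..pi/2} (\<lambda>x. \<bar>cos (\<alpha> - real b * x)\<bar>) = 2"
proof -
  \<comment> \<open>The image of -pi/2 under x -> b x - \<alpha>.\<close>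
  define c where "c = - \<alpha> - real b * pi / 2"
  have "integral {c..c + real b * pi} (\<lambda>x. \<bar>cos x\<bar>) = real b *\<^sub>R integral {- (pi/2)..- (pi/2) + pi} (\<lambda>x. \<bar>cos x\<bar>)"
    by (rule integral_periodic_multiple) (auto intro!: continuous_intros)
  then have 1: "integral {c..c + real b * pi} (\<lambda>x. \<bar>cos x\<bar>) = 2 * real b"
    using integral_abs_cos_half_period by simp
  have "(\<lambda>x. \<bar>cos x\<bar>) integrable_on {c..c + real b * pi}"
    by (intro integrable_continuous_interval continuous_intros)
  then have "((\<lambda>x. \<bar>cos x\<bar>) has_integral 2 * real b) (cbox c (c + real b * pi))"
    using 1 by (simp add: has_integral_iff)
  from has_integral_affinity'[OF this, of "real b" "-\<alpha>"] assms
  have "((\<lambda>x. \<bar>cos (real b * x - \<alpha>)\<bar>) has_integral 2) {(c + \<alpha>)/real b..(c + real b * pi + \<alpha>) / real b}"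
    by (simp add: field_simps)
  moreover have "(c + \<alpha>)/real b = - (pi/2)" "(c + real b * pi + \<alpha>)/real b = pi/2"
    using assms by (auto simp: c_def field_simps)
  moreover have "cos (real b * x - \<alpha>) = cos (\<alpha> - real b * x)" for x
    using cos_minus[of "real b * x - \<alpha>"] by simp
  ultimately show ?thesis by (simp add: has_integral_iff)
qed

section \<open>Orthogonality of the weight to Fourier modes\<close>

text \<open>A shift by \<open>s\<close> leaves the integral over a full period unchanged but also
  multiplies it by \<open>c\<close>, which differs from 1.\<close>

lemma integral_eq_0_of_shift_multiplier:
  fixes f :: "real \<Rightarrow> complex"
  assumes "continuous_on UNIV f" "\<And>x. f (x + T) = f x" "T \<ge> 0"
    and "\<And>x. f (x + s) = c * f x" "c \<noteq> 1"
  shows "integral {a..a+T} f = 0"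
proof -
  have "integral {a..a+T} f = integral {a+s..(a+s)+T} f"
    by (rule integral_periodic_interval) (use assms in auto)
  also have "\<dots> = integral {a..a+T} (\<lambda>x. f (x + s))"
    using integral_shift_Icc_real[of a "a+T" f s] by (simp add: o_def add_ac)
  also have "\<dots> = c * integral {a..a+T} f"
    using assms(4) by simp
  finally show ?thesis using assms(5) by simp
qed

lemma integral_interval_complex_of_real:
  assumes "continuous_on {a..b} f"
  shows "integral {a..b} (\<lambda>x::real. complex_of_real (f x)) = of_real (integral {a..b} f)"
  using integral_linear[OF integrable_continuous_interval[OF assms] bounded_linear_of_real[where 'a = complex]]
  by (simp add: o_def)

text \<open>Shifting by pi/b fixes the weight and multiplies the mode by
  \<open>cis (2 k pi / b)\<close>, which is not 1 because b does not divide k when 0 < |k| < b. The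
  frequency 2k is even, so the product has period pi, the length of the interval.\<close>

lemma integral_weight_cis_eq_0:
  fixes w :: "real \<Rightarrow> real"
  assumes "b > 0" "k \<noteq> 0" "\<bar>k\<bar> < int b"
    and "continuous_on UNIV w" "\<And>x. w (x + pi / real b) = w x"
  shows "integral {- (pi/2)..pi/2} (\<lambda>x. of_real (w x) * cis (2 * of_int k * x)) = 0"
proof -
  let ?f = "\<lambda>x. complex_of_real (w x) * cis (2 * of_int k * x)"
  have w_mult: "w (x + real j * (pi / real b)) = w x" for x j
  proof (induction j)
    case (Suc j)
    have "x + real (Suc j) * (pi / real b) = (x + real j * (pi / real b)) + pi / real b"
      by (simp add: algebra_simps add_divide_distrib)
    then show ?case using Suc.IH by (simp only: assms(5))
  qed simp
  have w_pi: "w (x + pi) = w x" for x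
    using w_mult[of x b] assms(1) by simp
  have "integral {- (pi/2)..- (pi/2) + pi} ?f = 0"
  proof (rule integral_eq_0_of_shift_multiplier[where s = "pi / real b" and c = "cis (2 * of_int k * pi / real b)"])
    show "continuous_on UNIV ?f"
      by (intro continuous_intros assms)
    show "?f (x + pi) = ?f x" for x
    proof -
      have "cis (2 * of_int k * (x + pi)) = cis (2 * of_int k * x) * cis (2 * pi * of_int k)"
        by (simp add: cis_mult algebra_simps)
      then show ?thesis using w_pi by (simp add: cis_multiple_2pi)
    qed
    show "?f (x + pi / real b) = cis (2 * of_int k * pi / real b) * ?f x" for x
      using assms(5) by (simp add: cis_mult algebra_simps)
    show "cis (2 * of_int k * pi / real b) \<noteq> 1"
    proof
      assume "cis (2 * of_int k * pi / real b) = 1"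
      then have "cos (2 * of_int k * pi / real b) = 1"
        by (simp add: complex_eq_iff)
      then obtain j :: int where "2 * of_int k * pi / real b = of_int j * 2 * pi"
        using cos_one_2pi_int by auto
      then have "real_of_int k = of_int j * real b"
        using assms(1) by (simp add: field_simps)
      then have "k = j * int b"
        by (metis of_int_eq_iff of_int_mult of_int_of_nat_eq)
      then have "int b dvd k" by simp
      then show False using assms(2,3) zdvd_imp_le[of "int b" "\<bar>k\<bar>"] by auto
    qed
  qed auto
  then show ?thesis by simp
qed

text \<open>Induction on p for all k at once: cos^2 x = (e^(2ix) + 2 + e^(-2ix)) / 4 trades two
  powers of the cosine for the modes k-1, k and k+1, and lowering p by one pays for raising |k| by
  one in the bound |k| + p < b. For p = 0, the mode k = 0 vanishes because 2/pi is the mean of the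
  weight, the others by orthogonality.\<close>

lemma integral_abs_cos_trig_mean:
  fixes k :: int
  assumes "\<bar>k\<bar> + int p < int b"
  shows "integral {- (pi/2)..pi/2} (\<lambda>x. of_real (\<bar>cos (\<alpha> - real b * x)\<bar> - 2 / pi) * (of_real (cos x ^ (2*p)) * cis (2 * of_int k * x))) = 0"
  using assms
proof (induction p arbitrary: k)
  case 0
  show ?case
  proof (cases "k = 0")
    case True
    have "integral {- (pi/2)..pi/2} (\<lambda>x. \<bar>cos (\<alpha> - real b * x)\<bar> - 2 / pi) = 2 - integral {- (pi/2)..pi/2} (\<lambda>x. 2/pi)"
      using 0 integral_abs_cos_scaled[of b \<alpha>]
      by (subst Henstock_Kurzweil_Integration.integral_diff)
         (auto intro!: integrable_continuous_interval continuous_intros)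
    then have "integral {- (pi/2)..pi/2} (\<lambda>x. \<bar>cos (\<alpha> - real b * x)\<bar> - 2 / pi) = 0" by simp
    moreover have "continuous_on {- (pi/2)..pi/2} (\<lambda>x. \<bar>cos (\<alpha> - real b * x)\<bar> - 2 / pi)"
      by (intro continuous_intros)
    ultimately show ?thesis using True
      by (simp add: integral_interval_complex_of_real del: of_real_diff)
  next
    case False
    have "\<bar>cos (\<alpha> - real b * (x + pi / real b))\<bar> = \<bar>cos (\<alpha> - real b * x)\<bar>" for x
      using cos_minus_pi[of "\<alpha> - real b * x"] 0 by (simp add: algebra_simps)
    then show ?thesis
      using 0 False integral_weight_cis_eq_0[of b k "\<lambda>x. \<bar>cos (\<alpha> - real b * x)\<bar> - 2 / pi"]
      by (simp add: continuous_intros)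
  qed
next
  case (Suc p)
  define h where "h = (\<lambda>j x. of_real (\<bar>cos (\<alpha> - real b * x)\<bar> - 2 / pi) * (of_real (cos x ^ (2*p)) * cis (2 * of_int j * x)))"
  have int: "h j integrable_on {- (pi/2)..pi/2}" for j
    unfolding h_def by (intro integrable_continuous_interval continuous_intros)
  have eq: "complex_of_real (cos x ^ (2 * Suc p)) * cis (2 * of_int k * x) =
    of_real (cos x ^ (2*p)) * (cis (2 * of_int (k+1) * x) + 2 * cis (2 * of_int k * x) + cis (2 * of_int (k-1) * x)) / 4" for x
  proof -
    have c: "complex_of_real (cos x) = (cis x + cis (-x)) / 2"
      by (simp add: complex_eq_iff)
    have "complex_of_real (cos x ^ (2 * Suc p)) * cis (2 * of_int k * x)
        = of_real (cos x ^ (2*p)) * ((of_real (cos x))\<^sup>2 * cis (2 * of_int k * x))"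
      by (simp add: power2_eq_square)
    also have "(of_real (cos x))\<^sup>2 * cis (2 * of_int k * x) =
       (cis x * cis x * cis (2 * of_int k * x) + 2 * (cis x * cis (-x)) * cis (2 * of_int k * x)
         + cis (-x) * cis (-x) * cis (2 * of_int k * x)) / 4"
      unfolding c by (simp add: power2_eq_square field_simps del: cis_inverse)
    also have "\<dots> = (cis (2 * of_int (k+1) * x) + 2 * cis (2 * of_int k * x) + cis (2 * of_int (k-1) * x)) / 4"
      by (simp add: cis_mult algebra_simps)
    finally show ?thesis by simp
  qed
  have ring: "w * (c * (u + 2 * v + v') / 4) = (w * (c * u) + 2 * (w * (c * v)) + w * (c * v')) / 4"
    for w c u v v' :: complex
    by (simp add: algebra_simps)
  have "integral {- (pi/2)..pi/2} (\<lambda>x. of_real (\<bar>cos (\<alpha> - real b * x)\<bar> - 2 / pi) * (of_real (cos x ^ (2 * Suc p)) * cis (2 * of_int k * x)))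
    = integral {- (pi/2)..pi/2} (\<lambda>x. (h (k+1) x + 2 * h k x + h (k-1) x) / 4)"
    by (rule Henstock_Kurzweil_Integration.integral_cong) (simp only: eq h_def ring)
  also have "\<dots> = (integral {- (pi/2)..pi/2} (h (k+1)) + 2 * integral {- (pi/2)..pi/2} (h k) + integral {- (pi/2)..pi/2} (h (k-1))) / 4"
    using int by (simp add: Henstock_Kurzweil_Integration.integral_add integrable_add)
  also have "\<dots> = 0"
    using Suc.IH[of k] Suc.IH[of "k+1"] Suc.IH[of "k-1"] Suc.prems by (simp add: h_def)
  finally show ?case .
qed

lemma integral_abs_cos_times_even_cos_power:
  assumes "p < b"
  shows "integral {- (pi/2)..pi/2} (\<lambda>x. \<bar>cos (\<alpha> - real b * x)\<bar> * cos x ^ (2*p))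
       = 2 / pi * integral {- (pi/2)..pi/2} (\<lambda>x. cos x ^ (2*p))"
proof -
  have "complex_of_real (integral {- (pi/2)..pi/2} (\<lambda>x. (\<bar>cos (\<alpha> - real b * x)\<bar> - 2 / pi) * cos x ^ (2*p))) = 0"
    using integral_abs_cos_trig_mean[of 0 p b \<alpha>] assms
    by (subst integral_interval_complex_of_real[symmetric]) (auto intro!: continuous_intros)
  then have "integral {- (pi/2)..pi/2} (\<lambda>x. \<bar>cos (\<alpha> - real b * x)\<bar> * cos x ^ (2*p) - 2 / pi * cos x ^ (2*p)) = 0"
    by (simp add: algebra_simps)
  then show ?thesis
    by (subst (asm) Henstock_Kurzweil_Integration.integral_diff)
       (auto intro!: integrable_continuous_interval continuous_intros)
qed

text \<open>The primitive sin x cos^(2p+1) x vanishes at both endpoints; with sin^2 = 1 - cos^2 its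
  derivative is (2p+2) cos^(2p+2) x - (2p+1) cos^(2p) x.\<close>

lemma integral_even_cos_power_Suc:
  "integral {- (pi/2)..pi/2} (\<lambda>x. cos x ^ (2 * Suc p))
     = real (2*p+1) / real (2*p+2) * integral {- (pi/2)..pi/2} (\<lambda>x. cos x ^ (2*p))"
proof -
  let ?I = "{- (pi/2)..pi/2}"
  have "((\<lambda>x. real (2*p+2) * cos x ^ (2*Suc p) - real (2*p+1) * cos x ^ (2*p)) has_integral
     sin (pi/2) * cos (pi/2) ^ (2*p+1) - sin (-(pi/2)) * cos (-(pi/2)) ^ (2*p+1)) ?I"
  proof (rule fundamental_theorem_of_calculus)
    fix x assume "x \<in> ?I"
    have "((\<lambda>x. sin x * cos x ^ (2*p+1)) has_real_derivative
       cos x * cos x ^ (2*p+1) + sin x * (real (2*p+1) * cos x ^ (2*p) * (- sin x))) (at x within ?I)"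
      by (rule has_field_derivative_at_within, rule
          DERIV_cong[OF DERIV_mult[OF DERIV_sin[of x] DERIV_power[OF DERIV_cos[of x], where n = "2*p+1"]]])
         (simp add: algebra_simps)
    moreover have "cos x * cos x ^ (2*p+1) + sin x * (real (2*p+1) * cos x ^ (2*p) * (- sin x)) =
       cos x ^ (2*Suc p) - real (2*p+1) * cos x ^ (2*p) * (sin x)\<^sup>2"
      by (simp add: power2_eq_square)
    moreover have "\<dots> = real (2*p+2) * cos x ^ (2*Suc p) - real (2*p+1) * cos x ^ (2*p)"
      unfolding sin_squared_eq by (simp add: algebra_simps power2_eq_square)
    ultimately show "((\<lambda>x. sin x * cos x ^ (2*p+1)) has_vector_derivative
       real (2*p+2) * cos x ^ (2*Suc p) - real (2*p+1) * cos x ^ (2*p)) (at x within ?I)"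
      by (simp only: has_real_derivative_iff_has_vector_derivative)
  qed simp
  then have "integral ?I (\<lambda>x. real (2*p+2) * cos x ^ (2*Suc p) - real (2*p+1) * cos x ^ (2*p)) = 0"
    by (simp add: has_integral_iff)
  then have "real (2*p+2) * integral ?I (\<lambda>x. cos x ^ (2*Suc p)) = real (2*p+1) * integral ?I (\<lambda>x. cos x ^ (2*p))"
    by (subst (asm) Henstock_Kurzweil_Integration.integral_diff)
       (auto intro!: integrable_continuous_interval continuous_intros simp del: of_nat_add of_nat_mult power_Suc mult_Suc_right)
  then show ?thesis by (simp add: field_simps)
qed

subsection \<open>Derivatives of Cauchy integrals of bounded functions\<close>

lemma has_field_derivative_quadratic_error:
  fixes f :: "complex \<Rightarrow> complex"
  assumes "open S" "w \<in> S" "\<And>z. z \<in> S \<Longrightarrow> norm (f z - f w - d * (z - w)) \<le> B * norm (z - w)^2"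
  shows "(f has_field_derivative d) (at w)"
proof -
  have ev: "\<forall>\<^sub>F z in at w. norm ((f z - f w) / (z - w) - d) \<le> B * norm (z - w)"
  proof -
    have "\<forall>\<^sub>F z in at w. z \<in> S \<and> z \<noteq> w"
      using assms(1,2) by (simp add: eventually_at_in_open eventually_conj_iff eventually_at_topological) blast
    then show ?thesis
    proof eventually_elim
      case (elim z)
      then have "(f z - f w) / (z - w) - d = (f z - f w - d * (z - w)) / (z - w)"
        by (simp add: diff_divide_distrib)
      also have "norm \<dots> \<le> B * norm (z - w)^2 / norm (z - w)"
        using assms(3) elim by (simp add: norm_divide divide_right_mono)
      also have "\<dots> = B * norm (z - w)"
        using elim by (simp add: power2_eq_square)
      finally show ?case .
    qed
  qed
  have "((\<lambda>z. B * norm (z - w)) \<longlongrightarrow> B * norm (w - w)) (at w)"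
    by (intro tendsto_intros)
  then have "((\<lambda>z. (f z - f w) / (z - w) - d) \<longlongrightarrow> 0) (at w)"
    using Lim_null_comparison[OF ev] by simp
  then show ?thesis
    by (simp add: has_field_derivative_iff LIM_zero_iff)
qed

text \<open>First-order Taylor expansion of each \<open>k t\<close> at \<open>w\<close> has
  remainder at most B t |z - w|^2 throughout the convex set S. Integrating over t leaves a quadratic
  error, which identifies the derivative.\<close>

lemma has_field_derivative_LINT_parameter:
  fixes k k' k'' :: "'a \<Rightarrow> complex \<Rightarrow> complex"
  assumes "open S" "convex S" "w \<in> S"
    and "\<And>t z. z \<in> S \<Longrightarrow> (k t has_field_derivative k' t z) (at z)"
    and "\<And>t z. z \<in> S \<Longrightarrow> (k' t has_field_derivative k'' t z) (at z)"
    and "\<And>t z. z \<in> S \<Longrightarrow> norm (k'' t z) \<le> B t"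
    and "\<And>z. z \<in> S \<Longrightarrow> integrable M (\<lambda>t. k t z)"
    and "integrable M (\<lambda>t. k' t w)" "integrable M B"
  shows "((\<lambda>z. LINT t|M. k t z) has_field_derivative (LINT t|M. k' t w)) (at w)"
proof (rule has_field_derivative_quadratic_error[OF assms(1,3)])
  fix z assume z: "z \<in> S"
  have bound: "norm (k t z - k t w - k' t w * (z - w)) \<le> B t * norm (z - w)^2" for t
  proof -
    let ?f = "\<lambda>i::nat. if i = 0 then k t else if i = 1 then k' t else k'' t"
    have "norm (?f 0 z - (\<Sum>i\<le>1. ?f i w * (z - w)^i / fact i)) \<le> B t * norm (z - w)^Suc 1 / fact 1"
      by (rule complex_Taylor[where S = S and n = 1 and f = ?f and B = "B t" and w = w and z = z])
         (use assms(2-6) z in \<open>auto intro: has_field_derivative_at_within simp: le_Suc_eq\<close>)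
    then show ?thesis by (simp add: algebra_simps power2_eq_square)
  qed
  have "(LINT t|M. k t z) - (LINT t|M. k t w) - (LINT t|M. k' t w) * (z - w)
      = (LINT t|M. k t z - k t w - k' t w * (z - w))"
    using assms(3,7,8) z by simp
  also have "norm \<dots> \<le> (LINT t|M. B t * norm (z - w)^2)"
    using assms(3,7,8,9) z bound by (intro order_trans[OF integral_norm_bound] integral_mono) auto
  finally show "norm ((LINT t|M. k t z) - (LINT t|M. k t w) - (LINT t|M. k' t w) * (z - w))
      \<le> (LINT t|M. B t) * norm (z - w)^2"
    by simp
qed

section \<open>Size and integrability of the kernels\<close>

lemma Im_le_norm_real_diff: "Im z \<le> norm (of_real t - z)"
  using abs_Im_le_cmod[of "of_real t - z"] by simp

text \<open>Two of the n factors |t - z| supply the decay 1 / (1 + t^2), through |t| \<le> |t - z| +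
  R and |t - z| \<ge> y; each remaining factor is at least y. The bound is uniform in z, so it can
  dominate on a whole ball.\<close>

lemma norm_inverse_power_le:
  assumes "Im z \<ge> y" "y > 0" "norm z \<le> R" "n \<ge> 2"
  shows "norm (1 / (of_real t - z)^n) \<le> (2 + (1 + 2 * R\<^sup>2) / y\<^sup>2) / y^(n-2) * (1 / (1 + t\<^sup>2))"
proof -
  define d where "d = norm (of_real t - z)"
  have d: "d \<ge> y" "d > 0"
    using Im_le_norm_real_diff[of z t] assms unfolding d_def by auto
  have "\<bar>t\<bar> \<le> d + R"
    using norm_triangle_ineq[of "of_real t - z" z] assms(3) by (simp add: d_def)
  then have "t\<^sup>2 \<le> (d + R)\<^sup>2"
    by (metis abs_ge_zero power2_abs power_mono)
  also have "\<dots> \<le> 2 * d\<^sup>2 + 2 * R\<^sup>2"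
    using sum_squares_bound[of d R] by (simp add: power2_sum)
  finally have "1 + t\<^sup>2 \<le> 2 * d\<^sup>2 + (1 + 2 * R\<^sup>2) * 1" by simp
  also have "(1 + 2 * R\<^sup>2) * 1 \<le> (1 + 2 * R\<^sup>2) * (d\<^sup>2 / y\<^sup>2)"
    using d assms(2) by (intro mult_left_mono) (auto simp: field_simps intro: power_mono add_pos_nonneg)
  finally have "1 + t\<^sup>2 \<le> (2 + (1 + 2 * R\<^sup>2) / y\<^sup>2) * d\<^sup>2"
    by (simp add: algebra_simps)
  then have 1: "1 / d\<^sup>2 \<le> (2 + (1 + 2 * R\<^sup>2) / y\<^sup>2) * (1 / (1 + t\<^sup>2))"
    using d by (simp add: field_simps add_pos_nonneg)
  have n: "2 + (n - 2) = n" using assms(4) by simp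
  have "norm (1 / (of_real t - z)^n) = 1 / d^(2 + (n-2))"
    unfolding n by (simp add: d_def norm_divide norm_power)
  also have "\<dots> = (1 / d^(n-2)) * (1 / d\<^sup>2)"
    by (simp only: power_add) simp
  also have "\<dots> \<le> (1 / y^(n-2)) * ((2 + (1 + 2 * R\<^sup>2) / y\<^sup>2) * (1 / (1 + t\<^sup>2)))"
    using d assms(2) 1 by (intro mult_mono frac_le power_mono) auto
  finally show ?thesis by simp
qed

lemma integrable_lebesgue_inverse_1_plus_square: "integrable lebesgue (\<lambda>t::real. 1 / (1 + t\<^sup>2))"
proof -
  have "set_integrable lborel UNIV (\<lambda>t::real. inverse (1 + t\<^sup>2))"
    using integrable_inverse_1_plus_square by simp
  then have "integrable lborel (\<lambda>t::real. 1 / (1 + t\<^sup>2))"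
    by (simp add: set_integrable_def inverse_eq_divide)
  then show ?thesis
    by (subst integrable_completion) auto
qed

lemma AE_abs_le_Linfty_norm:
  assumes "g \<in> Linfty"
  shows "AE t in lebesgue. \<bar>g t\<bar> \<le> Linfty_norm g" "Linfty_norm g \<ge> 0"
proof -
  let ?e = "esssup lebesgue (\<lambda>t. ereal \<bar>g t\<bar>)"
  have fin: "?e < \<infinity>" and [measurable]: "g \<in> borel_measurable lebesgue"
    using assms by (auto simp: Linfty_def)
  have "esssup lebesgue (\<lambda>t::real. 0::ereal) \<le> ?e"
    by (rule esssup_mono) auto
  then have nn: "0 \<le> ?e"
    by (simp add: esssup_const)
  then have e: "?e = ereal (Linfty_norm g)"
    using fin by (cases ?e) (auto simp: Linfty_norm_def)
  show "Linfty_norm g \<ge> 0" using nn e by simp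
  show "AE t in lebesgue. \<bar>g t\<bar> \<le> Linfty_norm g"
    using esssup_AE[of "\<lambda>t. ereal \<bar>g t\<bar>" lebesgue] by (simp add: e)
qed

lemma integrable_Linfty_mult:
  fixes h :: "real \<Rightarrow> complex"
  assumes "g \<in> Linfty" "h \<in> borel_measurable lebesgue" "\<And>t. norm (h t) \<le> C * (1 / (1 + t\<^sup>2))"
  shows "integrable lebesgue (\<lambda>t. of_real (g t) * h t)"
proof (rule Bochner_Integration.integrable_bound)
  show "integrable lebesgue (\<lambda>t. Linfty_norm g * (C * (1 / (1 + t\<^sup>2))))"
    using integrable_lebesgue_inverse_1_plus_square by (intro integrable_mult_right)
  have [measurable]: "g \<in> borel_measurable lebesgue"
    using assms(1) by (simp add: Linfty_def)
  show "(\<lambda>t. of_real (g t) * h t) \<in> borel_measurable lebesgue"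
    using assms(2) by measurable
  show "AE t in lebesgue. norm (of_real (g t) * h t) \<le> norm (Linfty_norm g * (C * (1 / (1 + t\<^sup>2))))"
    using AE_abs_le_Linfty_norm(1)[OF assms(1)]
  proof eventually_elim
    case (elim t)
    then have "\<bar>g t\<bar> * norm (h t) \<le> Linfty_norm g * (C * (1 / (1 + t\<^sup>2)))"
      using assms(3)[of t] AE_abs_le_Linfty_norm(2)[OF assms(1)] by (intro mult_mono) auto
    also have "\<dots> \<le> norm (Linfty_norm g * (C * (1 / (1 + t\<^sup>2))))"
      unfolding real_norm_def by (rule abs_ge_self)
    finally show ?case by (simp only: norm_mult norm_of_real)
  qed
qed

definition cauchy_integral :: "(real \<Rightarrow> real) \<Rightarrow> nat \<Rightarrow> complex \<Rightarrow> complex" where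
  "cauchy_integral g n z = (LINT t|lebesgue. of_real (g t) * (1 / (of_real t - z)^n))"

text \<open>The real correction term makes the integral converge and does not affect the real part
  of \<open>herglotz_integral g z / (\<pi> \<i>)\<close>.\<close>

definition herglotz_integral :: "(real \<Rightarrow> real) \<Rightarrow> complex \<Rightarrow> complex" where
  "herglotz_integral g z = (LINT t|lebesgue. of_real (g t) * (1 / (of_real t - z) - of_real (t / (1 + t\<^sup>2))))"

lemma measurable_cauchy_kernel:
  "(\<lambda>t. 1 / (complex_of_real t - z)^n) \<in> borel_measurable lebesgue"
  by (intro measurable_completion) (measurable; simp)

lemma integrable_cauchy_kernel:
  assumes "g \<in> Linfty" "Im z > 0" "n \<ge> 2"
  shows "integrable lebesgue (\<lambda>t. of_real (g t) * (1 / (of_real t - z)^n))"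
  by (rule integrable_Linfty_mult[OF assms(1) measurable_cauchy_kernel norm_inverse_power_le[OF order_refl assms(2) order_refl assms(3)]])

text \<open>The difference equals (1 + t z) / ((t - z) (1 + t^2)), and (1 + t z) / (t - z) = (1 +
  z^2) / (t - z) + z is bounded in t. The correction thus gains the order of decay that 1 / (t - z)
  lacks.\<close>

lemma norm_herglotz_kernel_le:
  assumes "Im z > 0"
  shows "norm (1 / (of_real t - z) - of_real (t / (1 + t\<^sup>2)))
    \<le> (norm (1 + z\<^sup>2) / Im z + norm z) * (1 / (1 + t\<^sup>2))"
proof -
  have nz: "of_real t - z \<noteq> 0"
    using assms by (auto simp: complex_eq_iff)
  have pos: "1 + t\<^sup>2 > 0" by (simp add: add_pos_nonneg)
  then have nz': "1 + (of_real t)\<^sup>2 \<noteq> (0::complex)"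
    by (metis of_real_1 of_real_add of_real_eq_0_iff of_real_power less_irrefl)
  have "1 / (of_real t - z) - of_real (t / (1 + t\<^sup>2)) = (1 + of_real t * z) / (of_real t - z) / (1 + (of_real t)\<^sup>2)"
    using nz nz' by (simp add: field_simps power2_eq_square)
  also have "(1 + of_real t * z) / (of_real t - z) = (1 + z\<^sup>2) / (of_real t - z) + z"
    using nz by (simp add: field_simps power2_eq_square)
  finally have eq: "1 / (of_real t - z) - of_real (t / (1 + t\<^sup>2)) = ((1 + z\<^sup>2) / (of_real t - z) + z) / of_real (1 + t\<^sup>2)"
    by simp
  have "norm ((1 + z\<^sup>2) / (of_real t - z) + z) \<le> norm (1 + z\<^sup>2) / norm (of_real t - z) + norm z"
    by (metis norm_divide norm_triangle_ineq)
  also have "\<dots> \<le> norm (1 + z\<^sup>2) / Im z + norm z"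
    using assms Im_le_norm_real_diff[of z t] by (intro add_mono divide_left_mono mult_pos_pos) auto
  finally show ?thesis
    unfolding eq using pos by (simp add: norm_divide divide_right_mono del: of_real_add of_real_power)
qed

lemma integrable_herglotz_kernel:
  assumes "g \<in> Linfty" "Im z > 0"
  shows "integrable lebesgue (\<lambda>t. of_real (g t) * (1 / (of_real t - z) - of_real (t / (1 + t\<^sup>2))))"
proof (rule integrable_Linfty_mult[OF assms(1) _ norm_herglotz_kernel_le[OF assms(2)]])
  show "(\<lambda>t. 1 / (complex_of_real t - z) - of_real (t / (1 + t\<^sup>2))) \<in> borel_measurable lebesgue"
    by (intro measurable_completion) (measurable; simp)
qed

section \<open>Differentiation of Herglotz and Cauchy integrals\<close>

lemma has_field_derivative_cauchy_kernel:
  assumes "complex_of_real t \<noteq> z" "n \<ge> 1"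
  shows "((\<lambda>z. 1 / (of_real t - z)^n - c) has_field_derivative of_nat n / (of_real t - z)^(n+1)) (at z)"
proof -
  obtain m where n: "n = Suc m" using assms(2) by (cases n) auto
  have nz: "of_real t - z \<noteq> 0" using assms by simp
  have "((\<lambda>z. (of_real t - z)^n) has_field_derivative - (of_nat n * (of_real t - z)^m)) (at z)"
    by (rule DERIV_cong[OF DERIV_power[OF DERIV_diff[OF DERIV_const DERIV_ident]]]) (simp add: n)
  then have "((\<lambda>z. inverse ((of_real t - z)^n)) has_field_derivative
      - (- (of_nat n * (of_real t - z)^m) * inverse (((of_real t - z)^n)^Suc (Suc 0)))) (at z)"
    using nz by (intro DERIV_inverse_fun) auto
  moreover have "- (- (of_nat n * a^m) * inverse ((a^n)^Suc (Suc 0))) = of_nat n / a^(n+1)"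
    if "a \<noteq> 0" for a :: complex
    using that unfolding n by (simp add: field_simps)
  ultimately have "((\<lambda>z. inverse ((of_real t - z)^n) - c) has_field_derivative of_nat n / (of_real t - z)^(n+1) - 0) (at z)"
    using nz by (intro DERIV_diff DERIV_const) (simp only: nz not_False_eq_True)
  then show ?thesis by (simp add: inverse_eq_divide)
qed

text \<open>Serves both the Herglotz integral (n = 1 with its correction as \<open>c\<close>) and
  the Cauchy integrals (n \<ge> 2, \<open>c\<close> = 0): \<open>c t\<close> does not depend on z
  and drops out on differentiating under the integral.\<close>

lemma has_field_derivative_LINT_cauchy_kernel:
  assumes "g \<in> Linfty" "Im w > 0" "n \<ge> 1"
    and "\<And>z. Im z > 0 \<Longrightarrow> integrable lebesgue (\<lambda>t. of_real (g t) * (1 / (of_real t - z)^n - c t))"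
  shows "((\<lambda>z. LINT t|lebesgue. of_real (g t) * (1 / (of_real t - z)^n - c t))
     has_field_derivative of_nat n * cauchy_integral g (n+1) w) (at w)"
proof -
  \<comment> \<open>With half the height of w as radius, every point of the ball has imaginary part
    above y and norm at most R, so one kernel bound serves the whole ball.\<close>
  define y where "y = Im w / 2"
  have y: "y > 0" using assms by (simp add: y_def)
  define R where "R = norm w + y"
  define C where "C = (2 + (1 + 2 * R\<^sup>2) / y\<^sup>2) / y^(n+2-2)"
  have ball: "Im z > y" "norm z \<le> R" if "z \<in> ball w y" for z
  proof -
    have "norm (z - w) < y" using that by (simp add: dist_norm norm_minus_commute)
    moreover have "\<bar>Im z - Im w\<bar> \<le> norm (z - w)" using abs_Im_le_cmod[of "z - w"] by simp
    moreover have "norm z \<le> norm w + norm (z - w)" using norm_triangle_sub by blast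
    ultimately show "Im z > y" "norm z \<le> R" by (auto simp: y_def R_def)
  qed
  have neq: "complex_of_real t \<noteq> z" if "z \<in> ball w y" for t z
    using ball(1)[OF that] y by auto
  have "((\<lambda>z. LINT t|lebesgue. of_real (g t) * (1 / (of_real t - z)^n - c t)) has_field_derivative
      (LINT t|lebesgue. of_real (g t) * (of_nat n / (of_real t - w)^(n+1)))) (at w)"
  \<comment> \<open>The second derivative has exponent n + 2, hence the form of \<open>C\<close>.
    The majorant is written as the norm of \<open>g t\<close> times a decaying kernel, so that its
    integrability is again a case of \<open>integrable_Linfty_mult\<close>.\<close>
  proof (rule has_field_derivative_LINT_parameter[where S = "ball w y"
        and k'' = "\<lambda>t z. of_real (g t) * (of_nat (n * (n+1)) / (of_real t - z)^(n+2))"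
        and B = "\<lambda>t. norm (complex_of_real (g t) * of_real (real (n * (n+1)) * (C * (1 / (1 + t\<^sup>2)))))"])
    show "((\<lambda>z. of_real (g t) * (1 / (of_real t - z)^n - c t)) has_field_derivative
        of_real (g t) * (of_nat n / (of_real t - z)^(n+1))) (at z)" if "z \<in> ball w y" for t z
      using has_field_derivative_cauchy_kernel[OF neq[OF that] assms(3)] by (rule DERIV_cmult)
    show "((\<lambda>z. of_real (g t) * (of_nat n / (of_real t - z)^(n+1))) has_field_derivative
        of_real (g t) * (of_nat (n * (n+1)) / (of_real t - z)^(n+2))) (at z)" if "z \<in> ball w y" for t z
      using DERIV_cmult[OF DERIV_cmult[OF has_field_derivative_cauchy_kernel[OF neq[OF that, of t], of "n+1" 0]],
          of "of_real (g t)" "of_nat n"]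
      by (simp only: diff_0_right times_divide_eq_right mult_1_right of_nat_mult mult.assoc add.assoc one_add_one)
    show "norm (of_real (g t) * (of_nat (n * (n+1)) / (of_real t - z)^(n+2)))
        \<le> norm (complex_of_real (g t) * of_real (real (n * (n+1)) * (C * (1 / (1 + t\<^sup>2)))))"
      if "z \<in> ball w y" for t z
    proof -
      have "norm (1 / (of_real t - z)^(n+2)) \<le> C * (1 / (1 + t\<^sup>2))"
        unfolding C_def using ball[OF that] y by (intro norm_inverse_power_le) auto
      then have le: "norm (1 / (of_real t - z)^(n+2)) \<le> norm (complex_of_real (C * (1 / (1 + t\<^sup>2))))"
        by (metis norm_of_real abs_ge_self order_trans)
      have "norm (complex_of_real (g t) * of_nat (n * (n+1))) * norm (1 / (of_real t - z)^(n+2))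
         \<le> norm (complex_of_real (g t) * of_nat (n * (n+1))) * norm (complex_of_real (C * (1 / (1 + t\<^sup>2))))"
        by (rule mult_left_mono[OF le]) simp
      moreover have "norm (complex_of_real (real (n * (n+1)) * (C * (1 / (1 + t\<^sup>2)))))
          = norm (of_nat (n * (n+1)) :: complex) * norm (complex_of_real (C * (1 / (1 + t\<^sup>2))))"
        by (simp only: of_real_mult[of "real (n * (n+1))"] of_real_of_nat_eq norm_mult)
      moreover have "norm (of_nat (n * (n+1)) / (of_real t - z)^(n+2))
          = norm (of_nat (n * (n+1)) :: complex) * norm (1 / (of_real t - z)^(n+2))"
        by (simp only: norm_mult[symmetric] times_divide_eq_right mult_1_right)
      ultimately show ?thesis
        by (simp only: norm_mult[of "complex_of_real (g t)"] mult.assoc)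
    qed
    show "integrable lebesgue (\<lambda>t. of_real (g t) * (1 / (of_real t - z)^n - c t))" if "z \<in> ball w y" for z
      using assms(4) ball(1)[OF that] y by simp
    show "integrable lebesgue (\<lambda>t. of_real (g t) * (of_nat n / (of_real t - w)^(n+1)))"
      using integrable_mult_right[OF integrable_cauchy_kernel[OF assms(1,2), of "n+1"], of "of_nat n"] assms(3)
      by (simp add: mult.commute)
    have C: "0 \<le> C" using y by (simp add: C_def)
    show "integrable lebesgue (\<lambda>t. norm (complex_of_real (g t) * of_real (real (n * (n+1)) * (C * (1 / (1 + t\<^sup>2))))))"
    proof (intro integrable_norm integrable_Linfty_mult[OF assms(1), where C = "real (n * (n+1)) * C"])
      show "(\<lambda>t. complex_of_real (real (n * (n+1)) * (C * (1 / (1 + t\<^sup>2))))) \<in> borel_measurable lebesgue"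
        by (intro measurable_completion) (measurable; simp)
      show "norm (complex_of_real (real (n * (n+1)) * (C * (1 / (1 + t\<^sup>2))))) \<le> real (n * (n+1)) * C * (1 / (1 + t\<^sup>2))" for t
        using C by (simp only: norm_of_real) (simp add: abs_mult)
    qed
  qed (use y in auto)
  moreover have "(LINT t|lebesgue. of_real (g t) * (of_nat n / (of_real t - w)^(n+1)))
      = of_nat n * cauchy_integral g (n+1) w"
    unfolding cauchy_integral_def by (subst integral_mult_right_zero[symmetric]) (simp add: mult.commute)
  ultimately show ?thesis by simp
qed

lemma has_field_derivative_herglotz_integral:
  assumes "g \<in> Linfty" "Im w > 0"
  shows "(herglotz_integral g has_field_derivative cauchy_integral g 2 w) (at w)"
  using has_field_derivative_LINT_cauchy_kernel[OF assms, of 1 "\<lambda>t. of_real (t / (1 + t\<^sup>2))"]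
    integrable_herglotz_kernel[OF assms(1)]
  by (simp add: herglotz_integral_def[abs_def] numeral_2_eq_2)

lemma has_field_derivative_cauchy_integral:
  assumes "g \<in> Linfty" "Im w > 0" "n \<ge> 2"
  shows "(cauchy_integral g n has_field_derivative of_nat n * cauchy_integral g (n+1) w) (at w)"
  using has_field_derivative_LINT_cauchy_kernel[OF assms(1,2), of n "\<lambda>t. 0"]
    integrable_cauchy_kernel[OF assms(1)] assms(3)
  by (simp add: cauchy_integral_def[of g n, abs_def])

text \<open>Division by \<i> turns the real part into the imaginary part of the integral, and Im (1
  / (t - z)) = Im z / |t - z|^2 is pi times the Poisson kernel.\<close>

lemma Re_herglotz_integral:
  assumes "g \<in> Linfty" "Im z > 0"
  shows "Re (herglotz_integral g z / (of_real pi * \<i>)) = poisson_integral g z"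
proof -
  have "Re (herglotz_integral g z / (of_real pi * \<i>)) = 1 / pi * Im (herglotz_integral g z)"
    by (simp add: Re_divide power2_eq_square)
  also have "Im (herglotz_integral g z) =
      (LINT t|lebesgue. Im (of_real (g t) * (1 / (of_real t - z) - of_real (t / (1 + t\<^sup>2)))))"
    unfolding herglotz_integral_def using integrable_herglotz_kernel[OF assms] by (rule integral_Im[symmetric])
  also have "(\<lambda>t. Im (of_real (g t) * (1 / (of_real t - z) - of_real (t / (1 + t\<^sup>2)))))
      = (\<lambda>t. Im z * g t / ((Re z - t)\<^sup>2 + (Im z)\<^sup>2))"
    by (auto simp: fun_eq_iff Im_divide power2_commute)
  finally show ?thesis by (simp add: poisson_integral_def)
qed

section \<open>Recovering derivatives from the real part\<close>

text \<open>Along every line through z the real part of f - F is locally 0, so its derivative c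
  satisfies Re (c v) = 0 for each direction v. The directions 1 and \<i> force c = 0.\<close>

lemma deriv_eq_of_Re_eq:
  assumes "open S" "z \<in> S" "f field_differentiable at z" "F field_differentiable at z"
    and "\<And>w. w \<in> S \<Longrightarrow> Re (f w) = Re (F w)"
  shows "deriv f z = deriv F z"
proof -
  define c where "c = deriv f z - deriv F z"
  have h: "((\<lambda>w. f w - F w) has_field_derivative c) (at z)"
    using assms(3,4) unfolding c_def by (intro DERIV_diff field_differentiable_derivI)
  have "Re (c * v) = 0" for v
  proof -
    have "((\<lambda>s::real. z + of_real s * v) has_vector_derivative v) (at 0)"
      by (auto intro!: derivative_eq_intros)
    moreover have "((\<lambda>w. f w - F w) has_field_derivative c) (at (z + of_real 0 * v))"
      using h by simp
    ultimately have "(((\<lambda>w. f w - F w) \<circ> (\<lambda>s::real. z + of_real s * v)) has_vector_derivative v * c) (at 0)"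
      by (intro field_vector_diff_chain_at) 
    then have 1: "((\<lambda>s::real. Re (f (z + of_real s * v) - F (z + of_real s * v))) has_real_derivative Re (c * v)) (at 0)"
      unfolding has_real_derivative_iff_has_vector_derivative
      using bounded_linear.has_vector_derivative[OF bounded_linear_Re] by (force simp: o_def mult.commute)
    have "((\<lambda>s::real. z + of_real s * v) \<longlongrightarrow> z + of_real 0 * v) (nhds 0)"
      by (intro tendsto_intros filterlim_ident)
    then have "\<forall>\<^sub>F s in nhds (0::real). z + of_real s * v \<in> S"
      using assms(1,2) by (auto dest!: topological_tendstoD)
    then have "\<forall>\<^sub>F s in nhds (0::real). Re (f (z + of_real s * v) - F (z + of_real s * v)) = 0"
      by eventually_elim (simp add: assms(5))
    then have "((\<lambda>s::real. Re (f (z + of_real s * v) - F (z + of_real s * v))) has_real_derivative 0) (at 0)"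
      by (subst DERIV_cong_ev[OF refl _ refl, where g = "\<lambda>_. 0"]) auto
    with 1 show ?thesis using DERIV_unique by blast
  qed
  from this[of 1] this[of \<i>] have "c = 0"
    by (simp add: complex_eq_iff)
  then show ?thesis by (simp add: c_def)
qed

lemma open_upper_half_plane: "open upper_half_plane"
  by (simp add: upper_half_plane_def open_halfspace_Im_gt)

text \<open>f and the Herglotz function of g have the same real part, hence the same first
  derivative; further differentiation acts on the kernel alone. The formula starts at order 1
  because the real part determines f only up to an imaginary constant.\<close>

lemma higher_deriv_eq_cauchy_integral:
  assumes f: "f analytic_on upper_half_plane" and u: "has_boundary_values (\<lambda>z. Re (f z)) g"
    and z: "z \<in> upper_half_plane"
  shows "(deriv ^^ Suc n) f z = fact (Suc n) / (of_real pi * \<i>) * cauchy_integral g (n + 2) z"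
  using z
proof (induction n arbitrary: z)
  case 0
  let ?F = "\<lambda>z. herglotz_integral g z / (of_real pi * \<i>)"
  have g: "g \<in> Linfty" and Re_f: "\<And>z. z \<in> upper_half_plane \<Longrightarrow> Re (f z) = poisson_integral g z"
    using u by (auto simp: has_boundary_values_def)
  have F: "(?F has_field_derivative cauchy_integral g 2 z / (of_real pi * \<i>)) (at z)"
    using has_field_derivative_herglotz_integral[OF g] 0 by (intro DERIV_cdivide) (auto simp: upper_half_plane_def)
  have "deriv f z = deriv ?F z"
  proof (rule deriv_eq_of_Re_eq[OF open_upper_half_plane 0])
    show "f field_differentiable at z"
      using f 0 analytic_on_imp_differentiable_at by blast
    show "?F field_differentiable at z"
      using F field_differentiable_def by blast
    show "Re (f w) = Re (?F w)" if "w \<in> upper_half_plane" for w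
      using that Re_f Re_herglotz_integral[OF g] by (simp add: upper_half_plane_def)
  qed
  also have "\<dots> = cauchy_integral g 2 z / (of_real pi * \<i>)"
    using F by (rule DERIV_imp_deriv)
  finally show ?case by (simp add: numeral_2_eq_2)
next
  case (Suc n)
  have g: "g \<in> Linfty" using u by (auto simp: has_boundary_values_def)
  let ?c = "fact (Suc n) / (of_real pi * \<i>) :: complex"
  have "\<forall>\<^sub>F w in nhds z. (deriv ^^ Suc n) f w = ?c * cauchy_integral g (n + 2) w"
    using eventually_nhds_in_open[OF open_upper_half_plane Suc.prems] by eventually_elim (rule Suc.IH)
  then have "deriv ((deriv ^^ Suc n) f) z = deriv (\<lambda>w. ?c * cauchy_integral g (n + 2) w) z"
    by (rule deriv_cong_ev) simp
  also have "\<dots> = ?c * (of_nat (n + 2) * cauchy_integral g (n + 2 + 1) z)"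
    using Suc.prems by (intro DERIV_imp_deriv DERIV_cmult has_field_derivative_cauchy_integral[OF g])
      (auto simp: upper_half_plane_def)
  also have "\<dots> = fact (Suc (Suc n)) / (of_real pi * \<i>) * cauchy_integral g (Suc n + 2) z"
  proof -
    have "fact (Suc (Suc n)) = (of_nat (n + 2) * fact (Suc n) :: complex)"
      by (simp only: fact_Suc[of "Suc n"]) simp
    then show ?thesis by (simp only: times_divide_eq_left times_divide_eq_right) (simp add: ac_simps)
  qed
  finally show ?case by simp
qed

text \<open>Every g in \<open>Linfty\<close> is realised by an admissible function, so extremal
  boundary data may be chosen freely when proving sharpness.\<close>

lemma herglotz_integral_has_boundary_values:
  assumes "g \<in> Linfty"
  shows "(\<lambda>z. herglotz_integral g z / (of_real pi * \<i>)) analytic_on upper_half_plane"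
    and "has_boundary_values (\<lambda>z. Re (herglotz_integral g z / (of_real pi * \<i>))) g"
proof -
  have "(\<lambda>z. herglotz_integral g z / (of_real pi * \<i>)) holomorphic_on upper_half_plane"
    unfolding holomorphic_on_open[OF open_upper_half_plane]
    using has_field_derivative_herglotz_integral[OF assms]
    by (fastforce simp: upper_half_plane_def intro: DERIV_cdivide)
  then show "(\<lambda>z. herglotz_integral g z / (of_real pi * \<i>)) analytic_on upper_half_plane"
    by (simp add: analytic_on_open[OF open_upper_half_plane])
  show "has_boundary_values (\<lambda>z. Re (herglotz_integral g z / (of_real pi * \<i>))) g"
    using assms Re_herglotz_integral by (simp add: has_boundary_values_def upper_half_plane_def)
qed

subsection \<open>The sharp constant\<close>

text \<open>Up to the factor (Im z)^n and a shift of \<alpha>, this is the L^1 norm of the real part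
  of the rotated kernel 1 / (t - z)^(n+1), written in the angle variable. For n = 2m it is the
  integral in the Kresin-Maz'ya formula.\<close>

definition kernel_norm :: "nat \<Rightarrow> real \<Rightarrow> real" where
  "kernel_norm n \<alpha> = integral {- (pi/2)..pi/2} (\<lambda>x. \<bar>cos (\<alpha> - real (n+1) * x)\<bar> * cos x ^ (n-1))"

lemma kernel_norm_bounded: "bdd_above (range (kernel_norm n))"
proof (rule bdd_aboveI2)
  fix \<alpha>
  have "kernel_norm n \<alpha> \<le> integral {- (pi/2)..pi/2} (\<lambda>x. 1)"
    unfolding kernel_norm_def
  proof (rule integral_le)
    show "\<bar>cos (\<alpha> - real (n+1) * x)\<bar> * cos x ^ (n-1) \<le> 1" if "x \<in> {- (pi/2)..pi/2}" for x
      using that by (intro mult_le_one power_le_one) (auto simp: cos_ge_zero)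
  qed (auto intro!: integrable_continuous_interval continuous_intros)
  then show "kernel_norm n \<alpha> \<le> pi" by simp
qed

lemma Re_of_real_mult: "Re (of_real a * z) = a * Re z"
  by simp

text \<open>The substitution \<open>t = Re z + Im z * tan \<phi>\<close> turns \<open>t - z\<close> into
  \<open>Im z / cos \<phi> * cis (\<phi> - \<pi>/2)\<close>.\<close>

lemma LINT_abs_Re_cauchy_kernel:
  assumes z: "Im z > 0" and n: "n \<ge> 1"
  shows "integrable lebesgue (\<lambda>t. \<bar>Re (cis \<beta> / (of_real t - z)^(n+1))\<bar>)" (is "integrable _ ?f")
    and "(LINT t|lebesgue. \<bar>Re (cis \<beta> / (of_real t - z)^(n+1))\<bar>)
       = kernel_norm n (\<beta> + real (n+1) * (pi/2)) / Im z ^ n"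
proof -
  define y where "y = Im z"
  have y: "y > 0" using z by (simp add: y_def)
  define s where "s = (\<lambda>\<phi>. Re z + y * tan \<phi>)"
  \<comment> \<open>Open, so that \<open>tan\<close> maps it bijectively onto the line; the
    transformed integrand \<open>h\<close> is continuous up to the endpoints, which do not affect
    its integral.\<close>
  define S where "S = {- (pi/2)<..<pi/2}"
  define h where "h = (\<lambda>\<phi>. \<bar>cos (\<beta> + real (n+1) * (pi/2) - real (n+1) * \<phi>)\<bar> * cos \<phi> ^ (n-1) / y^n)"
  have cos_pos: "cos \<phi> > 0" if "\<phi> \<in> S" for \<phi>
    using that by (intro cos_gt_zero_pi) (auto simp: S_def)
  have subst: "\<bar>y / (cos \<phi>)\<^sup>2\<bar> * ?f (s \<phi>) = h \<phi>" if "\<phi> \<in> S" for \<phi>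
  proof -
    have c: "cos \<phi> > 0" using cos_pos[OF that] .
    have "of_real (s \<phi>) - z = of_real (y / cos \<phi>) * cis (\<phi> - pi/2)"
      using c by (simp add: complex_eq_iff s_def y_def tan_def cos_diff sin_diff)
    then have "(of_real (s \<phi>) - z)^(n+1) = of_real ((y / cos \<phi>)^(n+1)) * cis (real (n+1) * (\<phi> - pi/2))"
      by (simp only: power_mult_distrib of_real_power Complex.DeMoivre)
    then have "cis \<beta> / (of_real (s \<phi>) - z)^(n+1)
        = of_real (1 / (y / cos \<phi>)^(n+1)) * (cis \<beta> / cis (real (n+1) * (\<phi> - pi/2)))"
      by (simp only: of_real_divide of_real_1 times_divide_times_eq mult_1_left)
    also have "cis \<beta> / cis (real (n+1) * (\<phi> - pi/2)) = cis (\<beta> + real (n+1) * (pi/2) - real (n+1) * \<phi>)"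
      by (simp only: cis_divide) (simp add: algebra_simps)
    finally have "Re (cis \<beta> / (of_real (s \<phi>) - z)^(n+1))
        = 1 / (y / cos \<phi>)^(n+1) * cos (\<beta> + real (n+1) * (pi/2) - real (n+1) * \<phi>)"
      by (simp only: Re_of_real_mult cis.sel)
    then have "?f (s \<phi>) = 1 / (y / cos \<phi>)^(n+1) * \<bar>cos (\<beta> + real (n+1) * (pi/2) - real (n+1) * \<phi>)\<bar>"
      using c y by (simp only: abs_mult) simp
    \<comment> \<open>The Jacobian of the substitution absorbs two of the n + 1 cosines and one of
      the n + 1 factors y.\<close>
    moreover have "\<bar>y / (cos \<phi>)\<^sup>2\<bar> * (1 / (y / cos \<phi>)^(n+1)) = cos \<phi> ^ (n-1) / y^n"
    proof -
      obtain k where k: "n = Suc k" using n by (cases n) auto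
      show ?thesis using c y unfolding k by (simp add: field_simps power2_eq_square)
    qed
    ultimately have "\<bar>y / (cos \<phi>)\<^sup>2\<bar> * ?f (s \<phi>)
        = cos \<phi> ^ (n-1) / y^n * \<bar>cos (\<beta> + real (n+1) * (pi/2) - real (n+1) * \<phi>)\<bar>"
      by (simp only: mult.assoc[symmetric])
    then show ?thesis by (simp only: h_def mult.commute[of "cos \<phi> ^ (n-1) / y^n"] times_divide_eq_right)
  qed
  have hc: "continuous_on {- (pi/2)..pi/2} h"
    unfolding h_def by (intro continuous_intros) (use y in auto)
  have "h absolutely_integrable_on {- (pi/2)..pi/2}"
    using absolutely_integrable_continuous_real[OF hc] .
  then have hS: "h absolutely_integrable_on S"
    by (rule set_integrable_subset) (auto simp: S_def)
  have "integral S h = integral {- (pi/2)..pi/2} h"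
    using integral_open_interval[of "- (pi/2)" "pi/2" h] by (simp add: S_def box_real)
  also have "\<dots> = kernel_norm n (\<beta> + real (n+1) * (pi/2)) / y^n"
    unfolding h_def kernel_norm_def by simp
  finally have int_h: "integral S h = kernel_norm n (\<beta> + real (n+1) * (pi/2)) / y^n" .
  have L: "(\<lambda>\<phi>. \<bar>y / (cos \<phi>)\<^sup>2\<bar> * ?f (s \<phi>)) absolutely_integrable_on S"
    by (rule iffD2[OF set_integrable_cong hS]) (rule refl | erule subst)+
  have I: "integral S (\<lambda>\<phi>. \<bar>y / (cos \<phi>)\<^sup>2\<bar> * ?f (s \<phi>)) = kernel_norm n (\<beta> + real (n+1) * (pi/2)) / y^n"
    unfolding int_h[symmetric] by (rule Henstock_Kurzweil_Integration.integral_cong) (rule subst)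
  have "(\<lambda>\<phi>. \<bar>y / (cos \<phi>)\<^sup>2\<bar> * ?f (s \<phi>)) absolutely_integrable_on S \<and>
      integral S (\<lambda>\<phi>. \<bar>y / (cos \<phi>)\<^sup>2\<bar> * ?f (s \<phi>)) = kernel_norm n (\<beta> + real (n+1) * (pi/2)) / y^n
    \<longleftrightarrow> ?f absolutely_integrable_on (s ` S) \<and>
      integral (s ` S) ?f = kernel_norm n (\<beta> + real (n+1) * (pi/2)) / y^n"
  proof (rule has_absolute_integral_change_of_variables_1')
    show "S \<in> sets lebesgue" by (simp add: S_def)
    show "(s has_real_derivative y / (cos \<phi>)\<^sup>2) (at \<phi> within S)" if "\<phi> \<in> S" for \<phi>
      unfolding s_def using cos_pos[OF that] by (auto intro!: derivative_eq_intros simp: field_simps)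
    show "inj_on s S"
      by (rule inj_on_inverseI[of _ "\<lambda>t. arctan ((t - Re z) / y)"])
         (use y in \<open>auto simp: s_def S_def arctan_tan\<close>)
  qed
  moreover have "s ` S = UNIV"
  proof -
    have "t = s (arctan ((t - Re z) / y)) \<and> arctan ((t - Re z) / y) \<in> S" for t
      using y arctan_lbound[of "(t - Re z) / y"] arctan_ubound[of "(t - Re z) / y"]
      by (simp add: s_def S_def tan_arctan)
    then show ?thesis by blast
  qed
  ultimately have f: "?f absolutely_integrable_on UNIV" "integral UNIV ?f = kernel_norm n (\<beta> + real (n+1) * (pi/2)) / y^n"
    using L I by auto
  from f(1) show "integrable lebesgue ?f"
    by (simp add: set_integrable_def)
  show "(LINT t|lebesgue. ?f t) = kernel_norm n (\<beta> + real (n+1) * (pi/2)) / Im z ^ n"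
    using set_lebesgue_integral_eq_integral(2)[OF f(1)] f(2) by (simp add: set_lebesgue_integral_def y_def)
qed

lemma Re_cis_mult_cauchy_integral:
  assumes "g \<in> Linfty" "Im z > 0" "n \<ge> 1"
  shows "integrable lebesgue (\<lambda>t. g t * Re (cis \<beta> / (of_real t - z)^(n+1)))"
    and "Re (cis \<beta> * cauchy_integral g (n+1) z) = (LINT t|lebesgue. g t * Re (cis \<beta> / (of_real t - z)^(n+1)))"
proof -
  let ?k = "\<lambda>t. cis \<beta> * (of_real (g t) * (1 / (of_real t - z)^(n+1)))"
  have eq: "Re (?k t) = g t * Re (cis \<beta> / (of_real t - z)^(n+1))" for t
  proof -
    have "?k t = of_real (g t) * (cis \<beta> / (of_real t - z)^(n+1))" by simp
    then show ?thesis by (simp only: Re_of_real_mult)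
  qed
  have int: "integrable lebesgue ?k"
    using assms by (intro integrable_mult_right integrable_cauchy_kernel) auto
  show "integrable lebesgue (\<lambda>t. g t * Re (cis \<beta> / (of_real t - z)^(n+1)))"
    using integrable_Re[OF int] by (simp only: eq)
  have "cis \<beta> * cauchy_integral g (n+1) z = (LINT t|lebesgue. ?k t)"
    unfolding cauchy_integral_def by (rule integral_mult_right_zero[symmetric])
  then have "Re (cis \<beta> * cauchy_integral g (n+1) z) = (LINT t|lebesgue. Re (?k t))"
    using integral_Re[OF int] by simp
  then show "Re (cis \<beta> * cauchy_integral g (n+1) z) = (LINT t|lebesgue. g t * Re (cis \<beta> / (of_real t - z)^(n+1)))"
    by (simp only: eq)
qed

section \<open>Duality between L^1 and L^infinity\<close>

text \<open>Multiplying by \<open>cis \<beta>\<close> with \<beta> = - Arg makes the integral real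
  and nonnegative, so only the real part of the rotated kernel matters; Hoelder's inequality then
  bounds it by its L^1 norm, which is at most the supremum over all phases.\<close>

lemma norm_cauchy_integral_le:
  assumes g: "g \<in> Linfty" and z: "Im z > 0" and n: "n \<ge> 1"
  shows "norm (cauchy_integral g (n+1) z) \<le> (SUP \<alpha>. kernel_norm n \<alpha>) / Im z ^ n * Linfty_norm g"
proof -
  let ?C = "cauchy_integral g (n+1) z"
  define \<beta> where "\<beta> = - Arg ?C"
  have "cis \<beta> * ?C = cis \<beta> * rcis (norm ?C) (Arg ?C)"
    by (simp only: rcis_cmod_Arg)
  also have "\<dots> = of_real (norm ?C)"
    by (simp add: rcis_def \<beta>_def cis_mult)
  finally have "norm ?C = Re (cis \<beta> * ?C)" by simp
  also have "\<dots> = (LINT t|lebesgue. g t * Re (cis \<beta> / (of_real t - z)^(n+1)))"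
    by (rule Re_cis_mult_cauchy_integral[OF assms])
  also have "\<dots> \<le> (LINT t|lebesgue. Linfty_norm g * \<bar>Re (cis \<beta> / (of_real t - z)^(n+1))\<bar>)"
  proof (rule integral_mono_AE)
    show "AE t in lebesgue. g t * Re (cis \<beta> / (of_real t - z)^(n+1)) \<le> Linfty_norm g * \<bar>Re (cis \<beta> / (of_real t - z)^(n+1))\<bar>"
      using AE_abs_le_Linfty_norm(1)[OF g]
    proof eventually_elim
      case (elim t)
      have "g t * Re (cis \<beta> / (of_real t - z)^(n+1)) \<le> \<bar>g t\<bar> * \<bar>Re (cis \<beta> / (of_real t - z)^(n+1))\<bar>"
        by (metis abs_ge_self abs_mult)
      also have "\<dots> \<le> Linfty_norm g * \<bar>Re (cis \<beta> / (of_real t - z)^(n+1))\<bar>"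
        using elim by (rule mult_right_mono) simp
      finally show ?case .
    qed
  qed (use Re_cis_mult_cauchy_integral[OF assms] LINT_abs_Re_cauchy_kernel[OF z n] in auto)
  also have "\<dots> = Linfty_norm g * (kernel_norm n (\<beta> + real (n+1) * (pi/2)) / Im z ^ n)"
    by (simp only: integral_mult_right_zero LINT_abs_Re_cauchy_kernel[OF z n])
  also have "\<dots> \<le> Linfty_norm g * ((SUP \<alpha>. kernel_norm n \<alpha>) / Im z ^ n)"
    using AE_abs_le_Linfty_norm(2)[OF g] z
    by (intro mult_left_mono divide_right_mono cSUP_upper kernel_norm_bounded) auto
  finally show ?thesis by (simp add: mult.commute)
qed

lemma LinftyI:
  assumes "g \<in> borel_measurable lebesgue" "\<And>t. \<bar>g t\<bar> \<le> 1"
  shows "g \<in> Linfty" "Linfty_norm g \<le> 1"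
proof -
  have [measurable]: "g \<in> borel_measurable lebesgue" by fact
  have le: "esssup lebesgue (\<lambda>t. ereal \<bar>g t\<bar>) \<le> 1"
    using assms(2) by (intro esssup_I) (auto simp: one_ereal_def)
  then show "g \<in> Linfty"
    using assms(1) by (auto simp: Linfty_def dest: order.strict_trans1)
  from le show "Linfty_norm g \<le> 1"
    unfolding Linfty_norm_def by (cases "esssup lebesgue (\<lambda>t. ereal \<bar>g t\<bar>)") auto
qed

text \<open>Tests the estimate on the Herglotz function of g at the point \<i>, where the power of
  Im z is 1.\<close>

lemma derivative_estimate_cauchy_integral:
  assumes "derivative_estimate (Suc k) C" "g \<in> Linfty"
  shows "fact (Suc k) / pi * norm (cauchy_integral g (k + 2) \<i>) \<le> C * Linfty_norm g"
proof -
  have i: "\<i> \<in> upper_half_plane" by (simp add: upper_half_plane_def)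
  note F = herglotz_integral_has_boundary_values[OF assms(2)]
  have "norm ((deriv ^^ Suc k) (\<lambda>z. herglotz_integral g z / (of_real pi * \<i>)) \<i>) \<le> C / Im \<i> ^ Suc k * Linfty_norm g"
    using assms(1) F i unfolding derivative_estimate_def by blast
  then show ?thesis
    unfolding higher_deriv_eq_cauchy_integral[OF F i]
    by (simp add: norm_mult norm_divide del: fact_Suc)
qed

lemma derivative_estimate_nonneg:
  assumes "derivative_estimate (Suc k) C"
  shows "C \<ge> 0"
proof -
  have "(\<lambda>_. 1) \<in> Linfty" by (rule LinftyI) auto
  then have "fact (Suc k) / pi * norm (cauchy_integral (\<lambda>_. 1) (k + 2) \<i>) \<le> C * Linfty_norm (\<lambda>_. 1)"
    by (rule derivative_estimate_cauchy_integral[OF assms])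
  moreover have "Linfty_norm (\<lambda>_. 1) = 1"
    by (simp add: Linfty_norm_def esssup_const)
  moreover have "0 \<le> fact (Suc k) / pi * norm (cauchy_integral (\<lambda>_. 1) (k + 2) \<i>)"
    by (intro mult_nonneg_nonneg divide_nonneg_pos) auto
  ultimately show ?thesis by (metis mult.right_neutral order_trans)
qed

text \<open>The estimate is the duality bound. For minimality, each phase \<alpha> is tested with g
  the sign of the real part of the rotated kernel, for which the integral of g times that real part
  is the full L^1 norm.\<close>

lemma is_sharp_constant_SUP_kernel_norm:
  assumes "n \<ge> 1"
  shows "is_sharp_constant n (fact n / pi * (SUP \<alpha>. kernel_norm n \<alpha>))"
proof -
  obtain k where k: "n = Suc k" using assms by (cases n) auto
  have "derivative_estimate n (fact n / pi * (SUP \<alpha>. kernel_norm n \<alpha>))"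
    unfolding derivative_estimate_def
  proof (intro allI impI ballI)
    fix f g z
    assume f: "f analytic_on upper_half_plane" "has_boundary_values (\<lambda>z. Re (f z)) g" and z: "z \<in> upper_half_plane"
    have g: "g \<in> Linfty" using f(2) by (simp add: has_boundary_values_def)
    have z': "Im z > 0" using z by (simp add: upper_half_plane_def)
    have "norm ((deriv ^^ n) f z) = fact n / pi * norm (cauchy_integral g (n+1) z)"
      using higher_deriv_eq_cauchy_integral[OF f z, of k] unfolding k
      by (simp add: norm_mult norm_divide del: fact_Suc funpow.simps)
    also have "\<dots> \<le> fact n / pi * ((SUP \<alpha>. kernel_norm n \<alpha>) / Im z ^ n * Linfty_norm g)"
      by (intro mult_left_mono norm_cauchy_integral_le g z' assms) auto
    finally show "norm ((deriv ^^ n) f z) \<le> fact n / pi * (SUP \<alpha>. kernel_norm n \<alpha>) / Im z ^ n * Linfty_norm g"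
      by simp
  qed
  moreover have "fact n / pi * (SUP \<alpha>. kernel_norm n \<alpha>) \<le> C" if C: "derivative_estimate n C" for C
  proof -
    have "kernel_norm n \<alpha> \<le> C * pi / fact n" for \<alpha>
    proof -
      \<comment> \<open>Undoes the phase shift that the tangent substitution produces.\<close>
      define \<beta> where "\<beta> = \<alpha> - real (n+1) * (pi/2)"
      define r where "r = (\<lambda>t. Re (cis \<beta> / (of_real t - \<i>)^(n+1)))"
      have "r \<in> borel_measurable lebesgue"
        unfolding r_def by (intro measurable_completion) (measurable; simp)
      then have "(\<lambda>t. sgn (r t)) \<in> borel_measurable lebesgue"
        by measurable
      then have g: "(\<lambda>t. sgn (r t)) \<in> Linfty" "Linfty_norm (\<lambda>t. sgn (r t)) \<le> 1"
        by (auto intro!: LinftyI simp: abs_sgn_eq)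
      have "kernel_norm n \<alpha> = (LINT t|lebesgue. \<bar>r t\<bar>)"
        using LINT_abs_Re_cauchy_kernel(2)[of \<i> n \<beta>] assms by (simp add: r_def \<beta>_def)
      also have "\<dots> = (LINT t|lebesgue. sgn (r t) * r t)"
        by (simp add: abs_sgn mult.commute)
      also have "\<dots> = Re (cis \<beta> * cauchy_integral (\<lambda>t. sgn (r t)) (n+1) \<i>)"
        unfolding r_def by (rule Re_cis_mult_cauchy_integral(2)[symmetric])
          (use g(1) assms in \<open>auto simp: r_def\<close>)
      also have "\<dots> \<le> norm (cis \<beta> * cauchy_integral (\<lambda>t. sgn (r t)) (n+1) \<i>)"
        by (rule complex_Re_le_cmod)
      also have "\<dots> = norm (cauchy_integral (\<lambda>t. sgn (r t)) (n+1) \<i>)"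
        by (simp add: norm_mult)
      finally have "fact n / pi * kernel_norm n \<alpha> \<le> fact n / pi * norm (cauchy_integral (\<lambda>t. sgn (r t)) (n+1) \<i>)"
        by (intro mult_left_mono) auto
      also have "\<dots> \<le> C * Linfty_norm (\<lambda>t. sgn (r t))"
        using derivative_estimate_cauchy_integral[of k C, OF _ g(1)] C unfolding k by simp
      \<comment> \<open>Nonnegativity of C allows the norm of the sign function to be replaced by
        its bound 1.\<close>
      also have "\<dots> \<le> C * 1"
        using derivative_estimate_nonneg[of k C] C g(2) unfolding k by (intro mult_left_mono) auto
      finally show ?thesis by (simp add: field_simps)
    qed
    then have "(SUP \<alpha>. kernel_norm n \<alpha>) \<le> C * pi / fact n"
      by (intro cSUP_least) auto
    then show ?thesis by (simp add: field_simps)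
  qed
  ultimately show ?thesis by (simp add: is_sharp_constant_def)
qed

subsection \<open>Wallis integrals\<close>

definition wallis :: "nat \<Rightarrow> real" where
  "wallis p = integral {- (pi/2)..pi/2} (\<lambda>x. cos x ^ (2*p))"

lemma wallis_0: "wallis 0 = pi"
  by (simp add: wallis_def)

lemma wallis_Suc: "wallis (Suc p) = real (2*p+1) / real (2*p+2) * wallis p"
  unfolding wallis_def by (rule integral_even_cos_power_Suc)

lemma wallis_pos: "wallis p > 0"
proof (induction p)
  case (Suc p)
  then show ?case unfolding wallis_Suc by (intro mult_pos_pos divide_pos_pos) auto
qed (simp add: wallis_0)

lemma wallis_Suc_less: "wallis (Suc p) < wallis p"
proof -
  have "real (2*p+1) / real (2*p+2) * wallis p < 1 * wallis p"
    using wallis_pos[of p] by (intro mult_strict_right_mono) auto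
  then show ?thesis by (simp add: wallis_Suc)
qed

text \<open>Passing from p to p + 1 multiplies the factorial by (2p+1)(2p+2) and the Wallis integral
  by (2p+1)/(2p+2), so the product gains (2p+1)^2.\<close>

lemma wallis_double_fact: "fact (2*p) * wallis p = pi * (real (double_fact (2*p-1)))\<^sup>2"
proof (induction p)
  case (Suc p)
  \<comment> \<open>At p = 0 the truncated 2p - 1 is 0, and \<open>double_fact 0\<close> = 1 stands
    in for (-1)!!.\<close>
  have df: "double_fact (2 * Suc p - 1) = (2*p+1) * double_fact (2*p-1)"
    by (cases p) auto
  have "fact (2 * Suc p) * wallis (Suc p)
      = real (2*p+2) * real (2*p+1) * fact (2*p) * (real (2*p+1) / real (2*p+2) * wallis p)"
    by (simp add: wallis_Suc)
  also have "\<dots> = (real (2*p+1))\<^sup>2 * (fact (2*p) * wallis p)"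
    by (simp add: power2_eq_square)
  also have "\<dots> = pi * (real (double_fact (2 * Suc p - 1)))\<^sup>2"
    unfolding Suc.IH df of_nat_mult by (simp add: power_mult_distrib)
  finally show ?case .
qed (simp add: wallis_0)

section \<open>Squeezing the odd power between even powers\<close>

lemma integral_abs_cos_times_even_cos_power':
  assumes "p < b"
  shows "((\<lambda>x. \<bar>cos (\<alpha> - real b * x)\<bar> * cos x ^ (2*p)) has_integral 2 / pi * wallis p) {- (pi/2)..pi/2}"
  unfolding wallis_def integral_abs_cos_times_even_cos_power[OF assms, of \<alpha>, symmetric]
  by (intro integrable_integral integrable_continuous_interval continuous_intros)

text \<open>With c = cos x, the mean of c^(2p) and c^(2p+2) exceeds c^(2p+1) by c^(2p) (1 - c)^2 /
  2. Both half-exponents lie below b = 2p + 3, so the weight averages out.\<close>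

lemma kernel_norm_le:
  "kernel_norm (2 * Suc p) \<alpha> \<le> (wallis p + wallis (Suc p)) / pi"
proof -
  let ?b = "2 * Suc p + 1"
  let ?w = "\<lambda>x. \<bar>cos (\<alpha> - real ?b * x)\<bar>"
  have maj: "((\<lambda>x. (1/2) * (?w x * cos x ^ (2*p) + ?w x * cos x ^ (2 * Suc p)))
      has_integral (1/2) * (2 / pi * wallis p + 2 / pi * wallis (Suc p))) {- (pi/2)..pi/2}"
    by (intro has_integral_mult_right has_integral_add integral_abs_cos_times_even_cos_power') auto
  have kn: "((\<lambda>x. ?w x * cos x ^ (2 * Suc p - 1)) has_integral kernel_norm (2 * Suc p) \<alpha>) {- (pi/2)..pi/2}"
    unfolding kernel_norm_def
    by (intro integrable_integral integrable_continuous_interval continuous_intros)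
  have le: "?w x * cos x ^ (2 * Suc p - 1) \<le> (1/2) * (?w x * cos x ^ (2*p) + ?w x * cos x ^ (2 * Suc p))" for x
  proof -
    have "0 \<le> (1/2) * (?w x * (cos x ^ (2*p) * (1 - cos x)\<^sup>2))"
      by (intro mult_nonneg_nonneg) (auto simp: power_mult)
    also have "\<dots> = (1/2) * (?w x * cos x ^ (2*p) + ?w x * cos x ^ (2 * Suc p)) - ?w x * cos x ^ (2 * Suc p - 1)"
      by (simp add: algebra_simps power2_eq_square)
    finally show ?thesis by simp
  qed
  have "kernel_norm (2 * Suc p) \<alpha> \<le> (1/2) * (2 / pi * wallis p + 2 / pi * wallis (Suc p))"
    by (rule has_integral_le[OF kn maj le])
  then show ?thesis by (simp add: field_simps)
qed

text \<open>From 2 - 3c + c^3 = (1 - c)^2 (2 + c) \<ge> 0 with c = cos x, multiplied by c^(2p+1) /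
  2. The simpler c^(2p+1) \<ge> c^(2p+2) would integrate to the desired lower bound without
  strictness; the combination 3, -1 leaves room for it.\<close>

lemma kernel_norm_ge:
  "kernel_norm (2 * Suc p) \<alpha> \<ge> (3 * wallis (Suc p) - wallis (Suc (Suc p))) / pi"
proof -
  let ?b = "2 * Suc p + 1"
  let ?w = "\<lambda>x. \<bar>cos (\<alpha> - real ?b * x)\<bar>"
  have "((\<lambda>x. (1/2) * (3 * (?w x * cos x ^ (2 * Suc p)) - ?w x * cos x ^ (2 * Suc (Suc p))))
      has_integral (1/2) * (3 * (2 / pi * wallis (Suc p)) - 2 / pi * wallis (Suc (Suc p)))) {- (pi/2)..pi/2}"
    by (intro has_integral_mult_right has_integral_diff integral_abs_cos_times_even_cos_power') auto
  moreover have "((\<lambda>x. ?w x * cos x ^ (2 * Suc p - 1)) has_integral kernel_norm (2 * Suc p) \<alpha>) {- (pi/2)..pi/2}"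
    unfolding kernel_norm_def
    by (intro integrable_integral integrable_continuous_interval continuous_intros)
  moreover have "(1/2) * (3 * (?w x * cos x ^ (2 * Suc p)) - ?w x * cos x ^ (2 * Suc (Suc p))) \<le> ?w x * cos x ^ (2 * Suc p - 1)"
    if "x \<in> {- (pi/2)..pi/2}" for x
  proof -
    have c: "0 \<le> cos x" "cos x \<le> 1" using that by (auto simp: cos_ge_zero)
    have "0 \<le> (1/2) * (?w x * (cos x ^ (2*p+1) * ((1 - cos x)\<^sup>2 * (2 + cos x))))"
      using c by (intro mult_nonneg_nonneg zero_le_power) auto
    also have "\<dots> = ?w x * cos x ^ (2 * Suc p - 1) - (1/2) * (3 * (?w x * cos x ^ (2 * Suc p)) - ?w x * cos x ^ (2 * Suc (Suc p)))"
      by (simp add: algebra_simps power2_eq_square)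
    finally show ?thesis by simp
  qed
  ultimately have "(1/2) * (3 * (2 / pi * wallis (Suc p)) - 2 / pi * wallis (Suc (Suc p))) \<le> kernel_norm (2 * Suc p) \<alpha>"
    by (rule has_integral_le) auto
  then show ?thesis by (simp add: field_simps)
qed

theorem theorem2:
  fixes m :: nat
  assumes "m \<ge> 1"
  shows "\<exists>K. is_sharp_constant (2 * m) K \<and>
    2 / pi * (real (double_fact (2 * m - 1)))\<^sup>2 < K \<and>
    K < 2 * real m / (2 * real m - 1) * (2 / pi) * (real (double_fact (2 * m - 1)))\<^sup>2"
proof -
  obtain p where p: "m = Suc p" using assms by (cases m) auto
  let ?S = "SUP \<alpha>. kernel_norm (2 * m) \<alpha>"
  have df: "(real (double_fact (2 * m - 1)))\<^sup>2 = fact (2 * m) * wallis m / pi"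
    by (simp add: wallis_double_fact)
  \<comment> \<open>Strictness on both sides comes from the strict decrease of the Wallis integrals.
    The bounds on the kernel norm are uniform in \<alpha>, so it survives the supremum.\<close>
  have "2 * wallis m / pi < (3 * wallis m - wallis (Suc m)) / pi"
    using wallis_Suc_less[of m] by (simp add: divide_strict_right_mono)
  also have "\<dots> \<le> kernel_norm (2 * m) 0"
    unfolding p by (rule kernel_norm_ge)
  also have "\<dots> \<le> ?S"
    by (intro cSUP_upper kernel_norm_bounded) auto
  finally have lower: "fact (2 * m) / pi * (2 * wallis m / pi) < fact (2 * m) / pi * ?S"
    by (intro mult_strict_left_mono) auto
  have "?S \<le> (wallis p + wallis m) / pi"
    unfolding p by (intro cSUP_least kernel_norm_le) auto
  also have "\<dots> < 2 * wallis p / pi"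
    using wallis_Suc_less[of p] by (simp add: p divide_strict_right_mono)
  \<comment> \<open>The Wallis recursion read backwards from m to p = m - 1; this is the source of
    the factor 2m / (2m - 1).\<close>
  also have "wallis p = 2 * real m / (2 * real m - 1) * wallis m"
  proof -
    define a b where "a = real (2*p+1)" and "b = real (2*p+2)"
    have "a > 0" "b > 0" by (simp_all add: a_def b_def)
    moreover have "wallis m = a / b * wallis p"
      by (simp only: p wallis_Suc a_def b_def)
    moreover have "2 * real m = b" "2 * real m - 1 = a"
      by (simp_all add: p a_def b_def)
    ultimately show ?thesis by simp
  qed
  finally have upper: "fact (2 * m) / pi * ?S < fact (2 * m) / pi * (2 * (2 * real m / (2 * real m - 1) * wallis m) / pi)"
    by (intro mult_strict_left_mono) auto
  have "2 / pi * (real (double_fact (2 * m - 1)))\<^sup>2 < fact (2 * m) / pi * ?S"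
    using lower unfolding df by (simp add: mult_ac)
  moreover have "fact (2 * m) / pi * ?S < 2 * real m / (2 * real m - 1) * (2 / pi) * (real (double_fact (2 * m - 1)))\<^sup>2"
    using upper unfolding df by (simp add: mult_ac)
  moreover have "is_sharp_constant (2 * m) (fact (2 * m) / pi * ?S)"
    using assms by (intro is_sharp_constant_SUP_kernel_norm) simp
  ultimately show ?thesis by blast
qed

end
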